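(* Let $G$ be a graph of order $n\ge 3$. If $G$ has property (P), then $G$ admits a zero-sum inverse realization of property (P); that is, there exists a nonsingular matrix $B\in S(G)$ with $P_\nu(B)=n$ and $\mathbf{1}^{\top}B^{-1}\mathbf{1}=0$, where $\mathbf{1}=(1,\dots,1)^\top\in\mathbb{R}^n$.
   Context: Graphs are finite and simple. For a graph $G$ on vertex set $\{1,\dots,n\}$, $S(G)$ is the set of real symmetric $n\times n$ matrices $A$ such that for all $i\ne j$, $A_{ij}\neq 0$ if and only if $ij\in E(G)$ (diagonal entries are unrestricted). $A(i)$ denotes the principal submatrix of $A$ obtained by deleting row and column $i$, and $m_A(0)$ the multiplicity of $0$ as an eigenvalue of $A$. A vertex $i$ is a P-vertex of $A$ if $m_{A(i)}(0)-m_A(0)=1$, and $P_\nu(A)$ is the number of P-vertices of $A$. $G$ has property (P) if there exists a nonsingular $A\in S(G)$ with $P_\nu(A)=n$ (equivalently, a nonsingular $A\in S(G)$ with $\det A(i)=0$ for all $i$, i.e. $A^{-1}$ has zero diagonal). A zero-sum inverse realization of property (P) for $G$ is a nonsingular $A\in S(G)$ with $P_\nu(A)=n$ and $\mathbf{1}^{\top}A^{-1}\mathbf{1}=0$, i.e. $\sum_{i,j}(A^{-1})_{ij}=0$. *)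

theory Defs
  imports
    Graph_Theory.Pair_Digraph
    Jordan_Normal_Form.Char_Poly
    Jordan_Normal_Form.Gauss_Jordan_Elimination
begin

(* A finite simple graph on n vertices is a term G with "pair_graph G" and
   "pverts G = {..<n}": each undirected edge ij is the pair of arcs (i, j), (j, i).
   Vertices are numbered from 0 to agree with matrix indices. *)

definition sym_matrices :: "nat pair_pre_digraph \<Rightarrow> real mat set" where
  "sym_matrices G = (let n = card (pverts G) in
     {A \<in> carrier_mat n n. transpose_mat A = A \<and>
        (\<forall>i<n. \<forall>j<n. i \<noteq> j \<longrightarrow> (A $$ (i, j) \<noteq> 0 \<longleftrightarrow> (i, j) \<in> parcs G))})"

definition eigenvalue_mult :: "real mat \<Rightarrow> real \<Rightarrow> nat" where
  "eigenvalue_mult A x = order x (char_poly A)"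

(* The difference is taken in int, since it can be negative. *)
definition P_vertex :: "real mat \<Rightarrow> nat \<Rightarrow> bool" where
  "P_vertex A i \<longleftrightarrow> i < dim_row A \<and>
     int (eigenvalue_mult (mat_delete A i i) 0) - int (eigenvalue_mult A 0) = 1"

definition P_nu :: "real mat \<Rightarrow> nat" where
  "P_nu A = card {i. P_vertex A i}"

definition property_P :: "nat pair_pre_digraph \<Rightarrow> bool" where
  "property_P G \<longleftrightarrow>
     (\<exists>A \<in> sym_matrices G. invertible_mat A \<and> P_nu A = card (pverts G))"

(* mat_inverse is partial; this lemma shows that "the (mat_inverse A)" is the inverse
   of every invertible A. *)
lemma the_mat_inverse:
  fixes A :: "'a :: field mat"
  assumes A: "A \<in> carrier_mat n n" and inv: "invertible_mat A"
  shows "the (mat_inverse A) \<in> carrier_mat n n"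
    and "A * the (mat_inverse A) = 1\<^sub>m n"
    and "the (mat_inverse A) * A = 1\<^sub>m n"
proof -
  from inv obtain B where B: "inverts_mat A B" "inverts_mat B A"
    unfolding invertible_mat_def by blast
  have AB: "A * B = 1\<^sub>m n" and BA: "B * A = 1\<^sub>m (dim_row B)"
    using B A by (auto simp: inverts_mat_def)
  have "dim_row B = n"
    using arg_cong[OF BA, of dim_col] A by simp
  moreover have "dim_col B = n"
    using arg_cong[OF AB, of dim_col] by simp
  ultimately have "A \<in> Units (ring_mat TYPE('a) n ())"
    using A AB BA by (auto simp: Units_def ring_mat_def intro!: bexI[of _ B])
  then obtain C where "mat_inverse A = Some C"
    using mat_inverse(1)[OF A, where b = "()"] by (cases "mat_inverse A") auto
  from mat_inverse(2)[OF A this] this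
  show "the (mat_inverse A) \<in> carrier_mat n n"
    and "A * the (mat_inverse A) = 1\<^sub>m n"
    and "the (mat_inverse A) * A = 1\<^sub>m n"
    by auto
qed

definition zero_sum_inverse_realization :: "nat pair_pre_digraph \<Rightarrow> real mat \<Rightarrow> bool" where
  "zero_sum_inverse_realization G B \<longleftrightarrow>
     (let n = card (pverts G); ones = vec n (\<lambda>_. 1) in
        B \<in> sym_matrices G \<and> invertible_mat B \<and> P_nu B = n \<and>
        ones \<bullet> (the (mat_inverse B) *\<^sub>v ones) = 0)"

end

(* Let M be the inverse of A. Scaling A to D^-1 A D^-1 with D = diag(y), all y_i nonzero,
   keeps the zero pattern and turns the inverse into D M D, whose diagonal is still zero and
   whose entries sum to the quadratic form of M at y. So one needs an isotropic vector of M
   without zero entries. The form has no square terms, hence is affine in each coordinate y_v;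
   for generic values of the others it has a nonzero slope, and also a nonzero constant
   term if the support graph of M has an edge avoiding v, so the root in y_v is nonzero.
   That P-vertices are exactly the zeros of the diagonal of M also needs det A(i) = 0 to force 0
   to be a simple eigenvalue of A(i): by symmetry a multiple eigenvalue would give a
   two-dimensional kernel, impossible for a principal submatrix of order n - 1 of a
   nonsingular matrix. *)
theory Submission
  imports Defs
begin

section \<open>Simplicity of the eigenvalue 0, and P-vertices as zeros of the diagonal of the
  inverse\<close>

text \<open>
  Cramer's rule with the kernel vector w in place of column k shows that w k times the
  characteristic polynomial is X times det R. If det R vanished at 0, a left kernel vector
  of R at 0 would be a kernel vector of C orthogonal to w.
\<close>
lemma order_char_poly_0_eq_1:
  fixes C :: "real mat"
  assumes C: "C \<in> carrier_mat m m" and w: "w \<in> carrier_vec m" "k < m" "w $ k \<noteq> 0"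
    and Cw: "C *\<^sub>v w = 0\<^sub>v m" and sym: "transpose_mat C = C"
    and ker: "\<And>z. z \<in> carrier_vec m \<Longrightarrow> C *\<^sub>v z = 0\<^sub>v m \<Longrightarrow> z \<bullet> w = 0 \<Longrightarrow> z = 0\<^sub>v m"
  shows "order 0 (char_poly C) = 1"
proof -
  let ?X = "[:0, 1:] :: real poly"
  let ?A = "char_poly_matrix C"
  define x where "x = map_vec (\<lambda>a. [:a:]) w"
  define R where "R = replace_col ?A x k"
  \<comment> \<open>The value of \<open>R\<close> at 0, where the characteristic matrix X - C
    becomes - C.\<close>
  define N where "N = replace_col (- C) w k"
  have A: "?A \<in> carrier_mat m m" using C by simp
  have R: "R \<in> carrier_mat m m" using A by (auto simp: R_def replace_col_def)
  have N: "N \<in> carrier_mat m m" using C by (auto simp: N_def replace_col_def)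
  have Cw': "(\<Sum>j<m. C $$ (i,j) * w $ j) = 0" if "i < m" for i
  proof -
    have "(C *\<^sub>v w) $ i = 0" using Cw that by simp
    thus ?thesis using that C w by (simp add: scalar_prod_def lessThan_atLeast0)
  qed
  have symC: "C $$ (i,j) = C $$ (j,i)" if "i < m" "j < m" for i j
    using arg_cong[OF sym, of "\<lambda>M. M $$ (i,j)"] that C by simp
  \<comment> \<open>As C w = 0, only the X on the diagonal acts on \<open>x\<close>.\<close>
  have Ax: "?A *\<^sub>v x = ?X \<cdot>\<^sub>v x"
  proof (rule eq_vecI)
    fix i assume "i < dim_vec (?X \<cdot>\<^sub>v x)"
    hence i: "i < m" using w by (simp add: x_def)
    have "(?A *\<^sub>v x) $ i = (\<Sum>j<m. ?A $$ (i,j) * x $ j)"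
      using i A w by (simp add: scalar_prod_def lessThan_atLeast0 x_def)
    also have "\<dots> = (\<Sum>j<m. (if i = j then ?X * x $ j else 0) - [:C $$ (i,j) * w $ j:])"
      using i C w by (intro sum.cong refl) (auto simp: char_poly_matrix_def x_def algebra_simps)
    also have "\<dots> = ?X * x $ i - (\<Sum>j<m. [:C $$ (i,j) * w $ j:])"
      using i by (simp add: sum_subtractf sum.delta)
    also have "(\<Sum>j<m. [:C $$ (i,j) * w $ j:]) = [:\<Sum>j<m. C $$ (i,j) * w $ j:]"
      by (rule poly_eqI) (simp add: coeff_sum coeff_pCons sum.If_cases split: nat.split)
    finally show "(?A *\<^sub>v x) $ i = (?X \<cdot>\<^sub>v x) $ i"
      using Cw'[OF i] i w by (simp add: x_def)
  qed (use A w in \<open>auto simp: x_def\<close>)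
  have "[:w $ k:] * char_poly C = det (replace_col ?A (?A *\<^sub>v x) k)"
    using cramer_lemma_mat[OF A, of x k] w by (simp add: x_def char_poly_def)
  \<comment> \<open>Transposing turns column k, which carries the factor X, into a row from which
    \<open>det_multrow\<close> can extract it.\<close>
  also have "\<dots> = det (transpose_mat (replace_col ?A (?A *\<^sub>v x) k))"
    by (rule det_transpose[symmetric, of _ m]) (use A in \<open>auto simp: replace_col_def\<close>)
  also have "transpose_mat (replace_col ?A (?A *\<^sub>v x) k) = multrow k ?X (transpose_mat R)"
    unfolding Ax using A w
    by (intro eq_matI) (auto simp: replace_col_def R_def x_def)
  also have "det \<dots> = ?X * det R"
    unfolding det_multrow[OF w(2) transpose_carrier_mat[THEN iffD2, OF R]] det_transpose[OF R] ..
  finally have eq: "Polynomial.smult (w $ k) (char_poly C) = ?X * det R" by simp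
  have "poly (det R) 0 = det N"
    by (rule poly_det_cong[OF N R])
      (use C w in \<open>auto simp: R_def N_def replace_col_def x_def char_poly_matrix_def\<close>)
  moreover have "det N \<noteq> 0"
  proof
    assume "det N = 0"
    hence "det (transpose_mat N) = 0" using det_transpose[OF N] by simp
    then obtain z where z: "z \<in> carrier_vec m" "z \<noteq> 0\<^sub>v m" "transpose_mat N *\<^sub>v z = 0\<^sub>v m"
      using det_0_iff_vec_prod_zero[of "transpose_mat N" m] N by auto
    have Nz: "(\<Sum>i<m. N $$ (i,j) * z $ i) = 0" if "j < m" for j
    proof -
      have "(transpose_mat N *\<^sub>v z) $ j = 0" using z that by simp
      thus ?thesis using that N z(1) by (simp add: scalar_prod_def lessThan_atLeast0)
    qed
    have "z \<bullet> w = (\<Sum>i<m. N $$ (i,k) * z $ i)"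
      using C w by (auto simp: scalar_prod_def lessThan_atLeast0 N_def replace_col_def
          intro!: sum.cong)
    hence zw: "z \<bullet> w = 0" using Nz w by simp
    \<comment> \<open>Column j of \<open>N\<close> is minus column j of C, which by symmetry is row
      j. Only row k of C z remains open, since column k of \<open>N\<close> is
      \<open>w\<close>.\<close>
    have off: "(\<Sum>i<m. C $$ (j,i) * z $ i) = 0" if "j < m" "j \<noteq> k" for j
    proof -
      have "(\<Sum>i<m. C $$ (j,i) * z $ i) = - (\<Sum>i<m. N $$ (i,j) * z $ i)"
        unfolding sum_negf[symmetric] using that C
        by (intro sum.cong refl) (auto simp: N_def replace_col_def symC)
      thus ?thesis using Nz that by simp
    qed
    \<comment> \<open>The missing row comes from w . (C z) = (C w) . z = 0: all other entries of C z
      vanish and \<open>w $ k\<close> is nonzero.\<close>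
    have "w $ k * (\<Sum>i<m. C $$ (k,i) * z $ i) = (\<Sum>j<m. w $ j * (\<Sum>i<m. C $$ (j,i) * z $ i))"
      using w off by (subst (2) sum.remove[of _ k]) (auto intro!: sum.neutral)
    also have "\<dots> = (\<Sum>i<m. \<Sum>j<m. w $ j * (C $$ (j,i) * z $ i))"
      unfolding sum_distrib_left by (rule sum.swap)
    also have "\<dots> = (\<Sum>i<m. z $ i * (\<Sum>j<m. C $$ (i,j) * w $ j))"
      unfolding sum_distrib_left by (intro sum.cong refl) (simp add: symC)
    also have "\<dots> = 0" using Cw' by simp
    finally have "(\<Sum>i<m. C $$ (j,i) * z $ i) = 0" if "j < m" for j
      using off that w by (cases "j = k") auto
    hence "C *\<^sub>v z = 0\<^sub>v m"
      using C z by (intro eq_vecI) (auto simp: scalar_prod_def lessThan_atLeast0)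
    from ker[OF z(1) this zw] z(2) show False by simp
  qed
  ultimately have dR: "poly (det R) 0 \<noteq> 0" by simp
  have "order 0 (char_poly C) = order 0 (Polynomial.smult (w $ k) (char_poly C))"
    using w by (simp add: order_smult)
  also have "\<dots> = order 0 ?X + order 0 (det R)"
    unfolding eq using dR by (intro order_mult) auto
  also have "order 0 (det R) = 0" using dR by (rule order_0I)
  also have "order 0 ?X = 1" using order_power_n_n[of "0::real" 1] by simp
  finally show ?thesis by simp
qed

lemma poly_char_poly_0_iff:
  fixes A :: "real mat"
  assumes A: "A \<in> carrier_mat n n"
  shows "poly (char_poly A) 0 = 0 \<longleftrightarrow> det A = 0"
proof -
  have "poly (char_poly A) 0 = det ((-1) \<cdot>\<^sub>m A)"
    unfolding char_poly_def
    by (rule poly_det_cong[of _ n]) (use A in \<open>auto simp: char_poly_matrix_def\<close>)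
  thus ?thesis by (simp add: det_smult)
qed

text \<open>A zero inserted at position i cancels column i of A, so the rows other than i see only
  the submatrix. This lifts kernel vectors of the submatrix to vectors on which A acts.\<close>

lemma mat_delete_mult_vec_eq:
  fixes A :: "real mat"
  assumes A: "A \<in> carrier_mat n n" and i: "i < n" and v: "v \<in> carrier_vec (n - 1)"
    and k: "k < n - 1"
  shows "(A *\<^sub>v vec n (\<lambda>j. if j = i then 0 else v $ delete_index i j)) $ insert_index i k
    = (mat_delete A i i *\<^sub>v v) $ k"
proof -
  have n: "Suc (n - 1) = n" using i by simp
  have img: "insert_index i ` {..<n - 1} = {..<n} - {i}"
    using insert_index_image[of i "n - 1"] i unfolding n lessThan_atLeast0 by simp
  have k': "insert_index i k < n" using k by (auto simp: insert_index_def)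
  have "(A *\<^sub>v vec n (\<lambda>j. if j = i then 0 else v $ delete_index i j)) $ insert_index i k
      = (\<Sum>j<n. A $$ (insert_index i k, j) * (if j = i then 0 else v $ delete_index i j))"
    using A k' by (simp add: scalar_prod_def lessThan_atLeast0)
  also have "\<dots> = (\<Sum>j\<in>{..<n} - {i}. A $$ (insert_index i k, j) * v $ delete_index i j)"
    using i by (subst sum.remove[of _ i]) auto
  also have "\<dots> = (\<Sum>j<n - 1. A $$ (insert_index i k, insert_index i j) * v $ j)"
    unfolding img[symmetric]
    by (subst sum.reindex[OF insert_index_inj_on]) simp
  also have "\<dots> = (\<Sum>j<n - 1. mat_delete A i i $$ (k, j) * v $ j)"
    using A k i
    by (intro sum.cong refl) (simp add: mat_delete_def insert_index_def)
  also have "\<dots> = (mat_delete A i i *\<^sub>v v) $ k"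
    using A k v by (simp add: scalar_prod_def lessThan_atLeast0)
  finally show ?thesis .
qed

text \<open>Since 0 is not an eigenvalue of A, a P-vertex is an i for which 0 has multiplicity
  exactly 1 in the submatrix. Singularity gives at least 1; \<open>order_char_poly_0_eq_1\<close>
  gives equality once the kernel is shown to be a line.\<close>

lemma P_vertex_iff_det:
  fixes A :: "real mat"
  assumes A: "A \<in> carrier_mat n n" and sym: "transpose_mat A = A"
    and det: "det A \<noteq> 0" and i: "i < n"
  shows "P_vertex A i \<longleftrightarrow> det (mat_delete A i i) = 0"
proof -
  let ?C = "mat_delete A i i"
  have C: "?C \<in> carrier_mat (n - 1) (n - 1)" by (rule mat_delete_carrier[OF A])
  have "order 0 (char_poly A) = 0"
    using poly_char_poly_0_iff[OF A] det by (intro order_0I) simp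
  hence P: "P_vertex A i \<longleftrightarrow> order 0 (char_poly ?C) = 1"
    using A i by (auto simp: P_vertex_def eigenvalue_mult_def)
  show ?thesis
  proof
    assume "P_vertex A i"
    hence "order 0 (char_poly ?C) \<noteq> 0" using P by simp
    thus "det ?C = 0" using order_0I poly_char_poly_0_iff[OF C] by metis
  next
    assume "det ?C = 0"
    then obtain w where w: "w \<in> carrier_vec (n - 1)" "w \<noteq> 0\<^sub>v (n - 1)" "?C *\<^sub>v w = 0\<^sub>v (n - 1)"
      using det_0_iff_vec_prod_zero[OF C] by auto
    obtain k where k: "k < n - 1" "w $ k \<noteq> 0"
      using w(1,2) by (metis eq_vecI carrier_vecD index_zero_vec)
    define E where "E v = vec n (\<lambda>j. if j = i then 0 else v $ delete_index i j)" for v :: "real vec"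
    have AE: "(A *\<^sub>v E v) $ j = 0"
      if "v \<in> carrier_vec (n - 1)" "?C *\<^sub>v v = 0\<^sub>v (n - 1)" "j < n" "j \<noteq> i" for v j
    proof -
      have "insert_index i (delete_index i j) = j" "delete_index i j < n - 1"
        using that i by (auto simp: insert_index_def delete_index_def)
      thus ?thesis using mat_delete_mult_vec_eq[OF A i that(1), of "delete_index i j"] that(2)
        by (simp add: E_def)
    qed
    have sym': "transpose_mat ?C = ?C"
    proof (rule eq_matI)
      fix a b assume "a < dim_row ?C" "b < dim_col ?C"
      hence ab: "a < n - 1" "b < n - 1" using C by auto
      have *: "A $$ (p, q) = A $$ (q, p)" if "p < n" "q < n" for p q
        using arg_cong[OF sym, of "\<lambda>M. M $$ (p,q)"] that A by simp
      show "transpose_mat ?C $$ (a, b) = ?C $$ (a, b)"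
        using ab A by (auto simp: mat_delete_def intro!: *)
    qed (use carrier_matD[OF C] in simp_all)
    have "order 0 (char_poly ?C) = 1"
    proof (rule order_char_poly_0_eq_1[OF C w(1) k w(3) sym'])
      fix z assume z: "z \<in> carrier_vec (n - 1)" "?C *\<^sub>v z = 0\<^sub>v (n - 1)" "z \<bullet> w = 0"
      define a b where "a = (A *\<^sub>v E w) $ i" and "b = (A *\<^sub>v E z) $ i"
      \<comment> \<open>Both extensions are mapped by A into the line spanned by the i-th unit vector.\<close>
      have inj: "u = 0\<^sub>v n" if "u \<in> carrier_vec n" "A *\<^sub>v u = 0\<^sub>v n" for u
        using det_0_iff_vec_prod_zero[OF A] det that by auto
      have Ev: "E v \<in> carrier_vec n" for v by (simp add: E_def)
      \<comment> \<open>The coefficients make entry i of the image equal to b * a - a * b = 0; the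
        other entries vanish by \<open>AE\<close>.\<close>
      have "A *\<^sub>v (b \<cdot>\<^sub>v E w - a \<cdot>\<^sub>v E z) = b \<cdot>\<^sub>v (A *\<^sub>v E w) - a \<cdot>\<^sub>v (A *\<^sub>v E z)"
        using Ev by (simp add: mult_minus_distrib_mat_vec[OF A] mult_mat_vec[OF A])
      also have "\<dots> = 0\<^sub>v n"
      proof (rule eq_vecI)
        fix j assume "j < dim_vec (0\<^sub>v n :: real vec)"
        hence j: "j < n" by simp
        show "(b \<cdot>\<^sub>v (A *\<^sub>v E w) - a \<cdot>\<^sub>v (A *\<^sub>v E z)) $ j = 0\<^sub>v n $ j"
          using j carrier_matD[OF A] AE[OF w(1,3) j] AE[OF z(1,2) j]
          by (cases "j = i") (simp_all add: a_def b_def del: index_mult_mat_vec)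
      qed (use A in auto)
      finally have comb: "b \<cdot>\<^sub>v E w - a \<cdot>\<^sub>v E z = 0\<^sub>v n" by (rule inj[rotated]) (simp add: Ev)
      have wz: "b * w $ j = a * z $ j" if j: "j < n - 1" for j
      proof -
        have jn: "insert_index i j < n" using j by (auto simp: insert_index_def)
        have "(b \<cdot>\<^sub>v E w - a \<cdot>\<^sub>v E z) $ insert_index i j = 0" using comb jn by simp
        thus ?thesis using jn by (simp add: E_def)
      qed
      have a: "a \<noteq> 0"
      proof
        assume "a = 0"
        hence "A *\<^sub>v E w = 0\<^sub>v n"
          using carrier_matD[OF A] AE[OF w(1,3)]
          by (intro eq_vecI) (metis a_def index_zero_vec, simp)
        hence "E w = 0\<^sub>v n" using Ev inj by simp
        hence "E w $ insert_index i k = 0" using k by (auto simp: insert_index_def)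
        moreover have "insert_index i k < n" using k by (auto simp: insert_index_def)
        ultimately show False using k by (simp add: E_def)
      qed
      \<comment> \<open>By \<open>wz\<close> the vectors a z and b w agree, but z is orthogonal to
        w, which forces z . z = 0.\<close>
      have "a * (z \<bullet> z) = (\<Sum>j<n - 1. (a * z $ j) * z $ j)"
        using z(1) by (simp add: scalar_prod_def lessThan_atLeast0 sum_distrib_left mult.assoc)
      also have "\<dots> = (\<Sum>j<n - 1. b * (z $ j * w $ j))"
        by (intro sum.cong refl) (simp flip: wz)
      also have "\<dots> = b * (z \<bullet> w)"
        using w(1) by (simp add: scalar_prod_def lessThan_atLeast0 sum_distrib_left)
      finally have "z \<bullet> z = 0" using a z(3) by simp
      hence "\<forall>j<n - 1. z $ j * z $ j = 0"
        using z(1) by (subst (asm) scalar_prod_def) (auto simp: sum_nonneg_eq_0_iff)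
      thus "z = 0\<^sub>v (n - 1)" using z(1) by (intro eq_vecI) auto
    qed
    thus "P_vertex A i" using P by simp
  qed
qed

lemma P_nu_eq_iff:
  assumes "A \<in> carrier_mat n n"
  shows "P_nu A = n \<longleftrightarrow> (\<forall>i<n. P_vertex A i)"
proof -
  have sub: "{i. P_vertex A i} \<subseteq> {..<n}" using assms by (auto simp: P_vertex_def)
  show ?thesis
  proof
    assume "P_nu A = n"
    hence "{i. P_vertex A i} = {..<n}"
      using sub by (intro card_subset_eq) (auto simp: P_nu_def)
    thus "\<forall>i<n. P_vertex A i" by auto
  next
    assume "\<forall>i<n. P_vertex A i"
    hence "{i. P_vertex A i} = {..<n}" using sub by auto
    thus "P_nu A = n" by (simp add: P_nu_def)
  qed
qed

text \<open>The diagonal of the adjugate consists of the principal minors of order n - 1, and the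
  adjugate is det A times the inverse.\<close>

lemma P_nu_eq_iff_inverse_diag:
  fixes A M :: "real mat"
  assumes A: "A \<in> carrier_mat n n" and M: "M \<in> carrier_mat n n"
    and sym: "transpose_mat A = A" and MA: "M * A = 1\<^sub>m n"
  shows "P_nu A = n \<longleftrightarrow> (\<forall>i<n. M $$ (i,i) = 0)"
proof -
  have "det M * det A = 1" using det_mult[OF M A] MA by simp
  hence det: "det A \<noteq> 0" by auto
  have "adj_mat A = (M * A) * adj_mat A" using MA adj_mat(1)[OF A] by simp
  also have "\<dots> = M * (A * adj_mat A)" using A M adj_mat(1)[OF A] by (rule_tac assoc_mult_mat)
  also have "\<dots> = det A \<cdot>\<^sub>m M"
    using mult_smult_distrib[OF M one_carrier_mat] M by (simp add: adj_mat(2)[OF A])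
  finally have adj: "adj_mat A = det A \<cdot>\<^sub>m M" .
  have "det (mat_delete A i i) = det A * M $$ (i,i)" if i: "i < n" for i
  proof -
    have "det (mat_delete A i i) = adj_mat A $$ (i,i)"
      using i A by (simp add: adj_mat_def cofactor_def)
    thus ?thesis using adj i M by simp
  qed
  thus ?thesis
    using P_nu_eq_iff[OF A] P_vertex_iff_det[OF A sym det] det by simp
qed

section \<open>Isotropic vectors without zero entries\<close>

lemma affine_eventually_nonzero:
  fixes a b :: real
  assumes "b \<noteq> 0"
  shows "\<forall>\<^sub>F t in at 0. a + t * b \<noteq> 0"
proof (cases "a = 0")
  case True
  \<comment> \<open>The filter \<open>at 0\<close> leaves out t = 0 itself, so t * b is
    nonzero.\<close>
  thus ?thesis using assms by (auto simp: eventually_at_filter)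
next
  case False
  have "((\<lambda>t. a + t * b) \<longlongrightarrow> a + 0 * b) (at 0)" by (intro tendsto_intros)
  thus ?thesis using False by (intro tendsto_imp_eventually_ne[of _ a]) simp_all
qed

text \<open>Vectors are functions here, so that changing one coordinate is a function
  update.\<close>

definition quad_form :: "nat \<Rightarrow> (nat \<Rightarrow> nat \<Rightarrow> real) \<Rightarrow> (nat \<Rightarrow> real) \<Rightarrow> real" where
  "quad_form n m x = (\<Sum>i<n. \<Sum>j<n. m i j * x i * x j)"

text \<open>Write the updated vector as z + s e_v and expand: the s^2 term has coefficient
  \<open>m v v\<close> = 0, and by symmetry the two cross terms agree, whence the factor 2.\<close>

lemma quad_form_fun_upd:
  assumes v: "v < n" and diag: "m v v = 0" and sym: "\<And>i j. i < n \<Longrightarrow> j < n \<Longrightarrow> m i j = m j i"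
  shows "quad_form n m (x(v := s)) = quad_form n m (x(v := 0)) + 2 * s * (\<Sum>j<n. m v j * x j)"
proof -
  define z where "z = x(v := 0)"
  define d where "d i = (if i = v then 1 else 0 :: real)" for i
  have upd: "(x(v := s)) i = z i + s * d i" for i by (simp add: z_def d_def)
  have delta: "(\<Sum>i<n. d i * f i) = f v" for f
    using v by (simp add: d_def if_distrib[of "\<lambda>c. c * _"] sum.delta cong: if_cong)
  have "quad_form n m (x(v := s)) = (\<Sum>i<n. \<Sum>j<n. m i j * z i * z j
      + s * (d i * (m i j * z j)) + s * (d j * (m i j * z i)) + s\<^sup>2 * (d i * (d j * m i j)))"
    unfolding quad_form_def upd
    by (intro sum.cong refl) (simp add: algebra_simps power2_eq_square)
  also have "\<dots> = quad_form n m z + s * (\<Sum>i<n. d i * (\<Sum>j<n. m i j * z j))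
      + s * (\<Sum>i<n. \<Sum>j<n. d j * (m i j * z i)) + s\<^sup>2 * (\<Sum>i<n. d i * (\<Sum>j<n. d j * m i j))"
    by (simp add: sum.distrib quad_form_def sum_distrib_left)
  also have "\<dots> = quad_form n m z + s * (\<Sum>j<n. m v j * z j) + s * (\<Sum>i<n. m i v * z i)"
    by (simp add: delta diag)
  also have "(\<Sum>i<n. m i v * z i) = (\<Sum>j<n. m v j * z j)"
    using v sym by (intro sum.cong refl) (metis lessThan_iff)
  also have "(\<Sum>j<n. m v j * z j) = (\<Sum>j<n. m v j * x j)"
    using diag by (intro sum.cong refl) (auto simp: z_def)
  finally show ?thesis unfolding z_def by linarith
qed

text \<open>Start at a point where the quadratic condition holds, move slightly along e_b to gain
  the linear one, then slightly along the all-ones vector to make all coordinates nonzero. By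
  continuity small moves keep what was gained before.\<close>

lemma exists_generic_point:
  fixes m :: "nat \<Rightarrow> nat \<Rightarrow> real"
  assumes diag: "\<And>i. i < n \<Longrightarrow> m i i = 0"
    and sym: "\<And>i j. i < n \<Longrightarrow> j < n \<Longrightarrow> m i j = m j i"
    and v: "v < n" "b < n" "m v b \<noteq> 0"
    and cd: "c < n" "d < n" "c \<noteq> v" "d \<noteq> v" "m c d \<noteq> 0"
  obtains x where "\<And>i. i < n \<Longrightarrow> x i \<noteq> 0" "(\<Sum>j<n. m v j * x j) \<noteq> 0"
    "quad_form n m (x(v := 0)) \<noteq> 0"
proof -
  have [simp]: "c \<noteq> d" using cd diag by auto
  define L where "L x = (\<Sum>j<n. m v j * x j)" for x
  define Q where "Q x = quad_form n m (x(v := 0))" for x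
  have lim: "((\<lambda>t. L (\<lambda>i. x i + t * y i)) \<longlongrightarrow> L x) (at 0)"
    "((\<lambda>t. Q (\<lambda>i. x i + t * y i)) \<longlongrightarrow> Q x) (at 0)" for x y
  proof -
    have *: "((\<lambda>t. x i + t * y i) \<longlongrightarrow> x i) (at 0)" for i
      by (rule tendsto_eq_intros refl | simp)+
    show "((\<lambda>t. L (\<lambda>i. x i + t * y i)) \<longlongrightarrow> L x) (at 0)"
      unfolding L_def by (intro tendsto_sum tendsto_mult tendsto_const *)
    have "((\<lambda>t. ((\<lambda>i. x i + t * y i)(v := 0)) i) \<longlongrightarrow> (x(v := 0)) i) (at 0)" for i
      using * by (cases "i = v") simp_all
    thus "((\<lambda>t. Q (\<lambda>i. x i + t * y i)) \<longlongrightarrow> Q x) (at 0)"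
      unfolding Q_def quad_form_def by (intro tendsto_sum tendsto_mult tendsto_const)
  qed
  define e where "e k i = (if i = k then 1 else 0 :: real)" for k i :: nat
  \<comment> \<open>This vector vanishes at v, and the zero diagonal leaves only the two cross
    terms, which add up to 2 * m c d.\<close>
  define u where "u = (\<lambda>i. e c i + e d i)"
  have delta: "(\<Sum>i<n. f i * e k i) = f k" if "k < n" for f k
    using that by (simp add: e_def if_distrib[of "\<lambda>c. _ * c"] sum.delta cong: if_cong)
  have "u(v := 0) = u" using cd by (auto simp: u_def e_def)
  hence "Q u = (\<Sum>i<n. (\<Sum>j<n. m i j * u j) * u i)"
    unfolding Q_def quad_form_def sum_distrib_right by (simp add: mult_ac)
  also have "\<dots> = 2 * m c d"
    using cd diag[of c] diag[of d] sym[of c d]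
    by (simp add: u_def distrib_left sum.distrib delta)
  finally have Qu: "Q u \<noteq> 0" using cd by simp
  have Lb: "L (\<lambda>i. u i + t * e b i) = L u + t * m v b" for t
    using delta[of b "m v"] v
    by (simp add: L_def distrib_left sum.distrib mult.left_commute flip: sum_distrib_left)
  have "\<forall>\<^sub>F t in at 0. L (\<lambda>i. u i + t * e b i) \<noteq> 0 \<and> Q (\<lambda>i. u i + t * e b i) \<noteq> 0"
    unfolding Lb
    by (intro eventually_conj affine_eventually_nonzero v tendsto_imp_eventually_ne[OF lim(2)] Qu)
  then obtain t where t: "L (\<lambda>i. u i + t * e b i) \<noteq> 0" "Q (\<lambda>i. u i + t * e b i) \<noteq> 0"
    using eventually_happens[of _ "at (0::real)"] by auto
  define w where "w = (\<lambda>i. u i + t * e b i)"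
  \<comment> \<open>In this direction each coordinate is affine in t with slope 1; the other two
    conditions already hold at t = 0.\<close>
  have "\<forall>\<^sub>F t in at 0. (\<forall>i\<in>{..<n}. w i + t * 1 \<noteq> 0) \<and> L (\<lambda>i. w i + t * 1) \<noteq> 0
      \<and> Q (\<lambda>i. w i + t * 1) \<noteq> 0"
    by (intro eventually_conj eventually_ball_finite ballI affine_eventually_nonzero
        tendsto_imp_eventually_ne[OF lim(1)] tendsto_imp_eventually_ne[OF lim(2)])
      (use t in \<open>auto simp: w_def\<close>)
  then obtain t' where "\<forall>i\<in>{..<n}. w i + t' * 1 \<noteq> 0" "L (\<lambda>i. w i + t' * 1) \<noteq> 0"
    "Q (\<lambda>i. w i + t' * 1) \<noteq> 0"
    using eventually_happens[of _ "at (0::real)"] by auto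
  thus ?thesis unfolding L_def Q_def by (intro that[of "\<lambda>i. w i + t' * 1"]) auto
qed

lemma exists_isotropic_nonzero_entries:
  fixes m :: "nat \<Rightarrow> nat \<Rightarrow> real"
  assumes n: "n \<ge> 3" and diag: "\<And>i. i < n \<Longrightarrow> m i i = 0"
    and sym: "\<And>i j. i < n \<Longrightarrow> j < n \<Longrightarrow> m i j = m j i"
    and row: "\<And>i. i < n \<Longrightarrow> \<exists>j<n. m i j \<noteq> 0"
  obtains y where "\<And>i. i < n \<Longrightarrow> y i \<noteq> 0" "quad_form n m y = 0"
proof -
  \<comment> \<open>No index is isolated in the support graph of m, so on at least three indices
    some edge avoids some vertex.\<close>
  obtain v c d where vcd: "v < n" "c < n" "d < n" "c \<noteq> v" "d \<noteq> v" "m c d \<noteq> 0"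
  proof -
    obtain b where b: "b < n" "m 0 b \<noteq> 0" using row[of 0] n by auto
    have "m 0 0 = 0" using diag[of 0] n by simp
    hence b0: "b \<noteq> 0" using b by metis
    \<comment> \<open>A vertex off the edge joining 0 and b, available as n is at least 3. It serves
      as the v of the claim, while 0 and b serve as its c and d.\<close>
    define c where "c = (if b = 1 then 2 else 1 :: nat)"
    have c: "c < n" "c \<noteq> 0" "c \<noteq> b" using n by (auto simp: c_def)
    show thesis using that[of c 0 b] b c n by auto
  qed
  \<comment> \<open>A nonzero entry in row v makes the slope in coordinate v a nonzero linear
    form.\<close>
  obtain b where b: "b < n" "m v b \<noteq> 0" using row vcd by blast
  obtain x where x: "\<And>i. i < n \<Longrightarrow> x i \<noteq> 0" "(\<Sum>j<n. m v j * x j) \<noteq> 0"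
    "quad_form n m (x(v := 0)) \<noteq> 0"
    by (rule exists_generic_point[OF diag sym vcd(1) b vcd(2-6)]) auto
  \<comment> \<open>As the form has no square terms, it is affine in the coordinate v.\<close>
  define s where "s = - quad_form n m (x(v := 0)) / (2 * (\<Sum>j<n. m v j * x j))"
  have "quad_form n m (x(v := s)) = 0"
    using quad_form_fun_upd[of v n m x s] vcd diag sym x by (simp add: s_def)
  moreover have "s \<noteq> 0" using x by (simp add: s_def)
  ultimately show thesis using that[of "x(v := s)"] x by auto
qed

section \<open>Inverses, diagonal scaling and the zero-sum realization\<close>

lemma transpose_inverse_symmetric:
  fixes A M :: "real mat"
  assumes A: "A \<in> carrier_mat n n" and M: "M \<in> carrier_mat n n"
    and sym: "transpose_mat A = A" and AM: "A * M = 1\<^sub>m n" and MA: "M * A = 1\<^sub>m n"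
  shows "transpose_mat M = M"
proof -
  have M': "transpose_mat M \<in> carrier_mat n n" using M by simp
  have "transpose_mat M * A = 1\<^sub>m n"
    using arg_cong[OF AM, of transpose_mat] transpose_mult[OF A M] sym by simp
  hence "(transpose_mat M * A) * M = M" using M by simp
  thus ?thesis using assoc_mult_mat[OF M' A M] AM M' by simp
qed

text \<open>For square matrices a right inverse is two-sided and unique. This identifies the inverse
  in \<open>zero_sum_inverse_realization\<close> with an explicit matrix.\<close>

lemma the_mat_inverse_eqI:
  fixes B N :: "real mat"
  assumes B: "B \<in> carrier_mat n n" and N: "N \<in> carrier_mat n n" and BN: "B * N = 1\<^sub>m n"
  shows "invertible_mat B" and "the (mat_inverse B) = N" and "N * B = 1\<^sub>m n"
proof -
  show NB: "N * B = 1\<^sub>m n" by (rule mat_mult_left_right_inverse[OF B N BN])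
  show inv: "invertible_mat B"
    using B N BN NB by (auto simp: invertible_mat_def inverts_mat_def intro!: exI[of _ N])
  let ?T = "the (mat_inverse B)"
  note T = the_mat_inverse[OF B inv]
  have "?T = ?T * (B * N)" using T BN by simp
  also have "\<dots> = (?T * B) * N" using assoc_mult_mat[OF T(1) B N] by simp
  finally show "?T = N" using T N by simp
qed

lemma sym_matrices_scale:
  assumes A: "A \<in> sym_matrices G" and n: "card (pverts G) = n"
    and y: "\<And>i. i < n \<Longrightarrow> y i \<noteq> 0"
  shows "mat n n (\<lambda>(i,j). A $$ (i,j) / (y i * y j)) \<in> sym_matrices G"
proof -
  have carr: "A \<in> carrier_mat n n" and sym: "transpose_mat A = A"
    using A n by (auto simp: sym_matrices_def Let_def)
  have "A $$ (i,j) = A $$ (j,i)" if "i < n" "j < n" for i j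
    using arg_cong[OF sym, of "\<lambda>M. M $$ (i,j)"] that carr by simp
  thus ?thesis using A n y
    by (auto simp: sym_matrices_def Let_def mult.commute intro!: eq_matI)
qed

theorem theorem2p7:
  fixes G :: "nat pair_pre_digraph" and n :: nat
  assumes "pair_graph G"
    and "pverts G = {..<n}"
    and "n \<ge> 3"
    and "property_P G"
  shows "\<exists>B. zero_sum_inverse_realization G B"
proof -
  have card: "card (pverts G) = n" using assms by simp
  obtain A where AS: "A \<in> sym_matrices G" and inv: "invertible_mat A" and nu: "P_nu A = n"
    using assms(4) card by (auto simp: property_P_def)
  have A: "A \<in> carrier_mat n n" and sym: "transpose_mat A = A"
    using AS card by (auto simp: sym_matrices_def Let_def)
  define M where "M = the (mat_inverse A)"
  have M: "M \<in> carrier_mat n n" and AM: "A * M = 1\<^sub>m n" and MA: "M * A = 1\<^sub>m n"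
    unfolding M_def by (rule the_mat_inverse[OF A inv])+
  have diag: "M $$ (i,i) = 0" if "i < n" for i
    using P_nu_eq_iff_inverse_diag[OF A M sym MA] nu that by blast
  have symM: "M $$ (i,j) = M $$ (j,i)" if "i < n" "j < n" for i j
    using arg_cong[OF transpose_inverse_symmetric[OF A M sym AM MA], of "\<lambda>M. M $$ (i,j)"] that M
    by simp
  have AM_entry: "(\<Sum>k<n. A $$ (i,k) * M $$ (k,j)) = (if i = j then 1 else 0)"
    if "i < n" "j < n" for i j
    using arg_cong[OF AM, of "\<lambda>M. M $$ (i,j)"] that A M
    by (simp add: scalar_prod_def lessThan_atLeast0)
  \<comment> \<open>By symmetry a zero row of \<open>M\<close> is also a zero column, which would
    make a diagonal entry of \<open>A * M\<close> vanish.\<close>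
  have row: "\<exists>j<n. M $$ (i,j) \<noteq> 0" if i: "i < n" for i
  proof (rule ccontr)
    assume "\<not> ?thesis"
    hence "(\<Sum>k<n. A $$ (i,k) * M $$ (k,i)) = 0"
      using i symM by (intro sum.neutral) auto
    thus False using AM_entry[OF i i] by simp
  qed
  obtain y where y: "\<And>i. i < n \<Longrightarrow> y i \<noteq> 0" and iso: "quad_form n (\<lambda>i j. M $$ (i,j)) y = 0"
    by (rule exists_isotropic_nonzero_entries[OF assms(3) diag symM row]) auto
  define B where "B = mat n n (\<lambda>(i,j). A $$ (i,j) / (y i * y j))"
  define N where "N = mat n n (\<lambda>(i,j). M $$ (i,j) * y i * y j)"
  have B: "B \<in> carrier_mat n n" and N: "N \<in> carrier_mat n n" by (simp_all add: B_def N_def)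
  have BS: "B \<in> sym_matrices G" unfolding B_def by (rule sym_matrices_scale[OF AS card y])
  hence symB: "transpose_mat B = B" by (auto simp: sym_matrices_def Let_def)
  have "B * N = 1\<^sub>m n"
  proof (rule eq_matI)
    fix i j assume "i < dim_row (1\<^sub>m n)" "j < dim_col (1\<^sub>m n)"
    hence ij: "i < n" "j < n" by simp_all
    have "(B * N) $$ (i,j) = (\<Sum>k<n. B $$ (i,k) * N $$ (k,j))"
      using ij B N by (simp add: scalar_prod_def lessThan_atLeast0)
    \<comment> \<open>The inner factors \<open>y k\<close> cancel. The remaining y j / y i is 1 on
      the diagonal and multiplies 0 elsewhere.\<close>
    also have "\<dots> = (\<Sum>k<n. y j / y i * (A $$ (i,k) * M $$ (k,j)))"
      using ij y by (intro sum.cong refl) (simp add: B_def N_def)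
    also have "\<dots> = 1\<^sub>m n $$ (i,j)"
      unfolding sum_distrib_left[symmetric] using ij y by (simp add: AM_entry)
    finally show "(B * N) $$ (i,j) = 1\<^sub>m n $$ (i,j)" .
  qed (use B N in auto)
  note inverse = the_mat_inverse_eqI[OF B N this]
  \<comment> \<open>The criterion that gave the zero diagonal of \<open>M\<close> is now read
    backwards: the diagonal entries of \<open>N\<close> are those of \<open>M\<close> times squares
    of the \<open>y i\<close>.\<close>
  have "P_nu B = n"
    using P_nu_eq_iff_inverse_diag[OF B N symB inverse(3)] diag by (simp add: N_def)
  moreover have "vec n (\<lambda>_. 1) \<bullet> (N *\<^sub>v vec n (\<lambda>_. 1)) = quad_form n (\<lambda>i j. M $$ (i,j)) y"
    by (simp add: scalar_prod_def quad_form_def N_def lessThan_atLeast0)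
  ultimately have "zero_sum_inverse_realization G B"
    using BS inverse card iso by (simp add: zero_sum_inverse_realization_def Let_def)
  thus ?thesis ..
qed

end
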